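(* For all integers $3\le a_1\le a_2\le a_3$, the sequence $(K_{a_1},K_{a_2},K_{a_3})$ is nice. In particular, $r^*(K_{a_1},K_{a_2},K_{a_3})=R(a_2,a_3)-1$.
   Context: $R(a,b)$ is the classical two-colour Ramsey number. A colouring $\xi:\binom{[r]}{\le 2}\to[k]$ (on subsets of $[r]$ of size at most 2) is feasible with respect to $(H_1,\ldots,H_k)$ if (P1) for each $i\in[k]$ there is no homomorphism from $H_i$ to the graph on $[r]$ formed by the pairs of $\xi$-colour $i$ (for cliques $H_i=K_{a}$ this means no colour-$i$ copy of $K_a$), and (P2) $\xi(\{x,y\})\ne\xi(\{x\})$ for all distinct $x,y\in[r]$. $r^*(H_1,\ldots,H_k)$ is the largest $r$ admitting a feasible colouring, and $(H_1,\ldots,H_k)$ is nice if every feasible colouring of $\binom{[r^*]}{\le 2}$ assigns the same colour to all singletons. *)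

theory Defs
  imports Main "HOL-Library.FuncSet" "HOL-Library.Ramsey"
begin

text \<open>
  A graph is a pair of a vertex set and a set of two-element edges. Vertices \<open>[r]\<close> and
  colours \<open>[k]\<close> are numbered from \<open>0\<close>, as in \<^theory>\<open>HOL-Library.Ramsey\<close>.
\<close>

type_synonym 'a sgraph = "'a set \<times> 'a set set"

definition complete_graph :: "nat \<Rightarrow> nat sgraph" where
  "complete_graph a = ({..<a}, [{..<a}]\<^bsup>2\<^esup>)"

definition graph_hom :: "'a sgraph \<Rightarrow> 'b sgraph \<Rightarrow> ('a \<Rightarrow> 'b) \<Rightarrow> bool" where
  "graph_hom G H f \<longleftrightarrow> f \<in> fst G \<rightarrow> fst H \<and> (\<forall>e\<in>snd G. f ` e \<in> snd H)"

definition subsets_upto2 :: "nat \<Rightarrow> nat set set" where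
  "subsets_upto2 r = {X. X \<subseteq> {..<r} \<and> card X \<le> 2}"

definition colour_graph :: "nat \<Rightarrow> (nat set \<Rightarrow> nat) \<Rightarrow> nat \<Rightarrow> nat sgraph" where
  "colour_graph r \<xi> i = ({..<r}, {e \<in> [{..<r}]\<^bsup>2\<^esup>. \<xi> e = i})"

definition feasible :: "'a sgraph list \<Rightarrow> nat \<Rightarrow> (nat set \<Rightarrow> nat) \<Rightarrow> bool" where
  "feasible Hs r \<xi> \<longleftrightarrow>
     \<xi> \<in> subsets_upto2 r \<rightarrow> {..<length Hs} \<and>
     (\<forall>i<length Hs. \<nexists>f. graph_hom (Hs ! i) (colour_graph r \<xi> i) f) \<and>
     (\<forall>x<r. \<forall>y<r. x \<noteq> y \<longrightarrow> \<xi> {x, y} \<noteq> \<xi> {x})"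

text \<open>
  As always with \<open>GREATEST\<close>, the value is meaningful only when the set of such \<open>r\<close> is nonempty
  and bounded.
\<close>

definition r_star :: "'a sgraph list \<Rightarrow> nat" where
  "r_star Hs = (GREATEST r. \<exists>\<xi>. feasible Hs r \<xi>)"

definition nice :: "'a sgraph list \<Rightarrow> bool" where
  "nice Hs \<longleftrightarrow>
     (\<forall>\<xi>. feasible Hs (r_star Hs) \<xi> \<longrightarrow>
        (\<forall>x<r_star Hs. \<forall>y<r_star Hs. \<xi> {x} = \<xi> {y}))"

definition ramsey_number :: "nat \<Rightarrow> nat \<Rightarrow> nat" where
  "ramsey_number a b = (LEAST n. partn_lst {..<n} [a, b] 2)"

end

theory Submission
  imports Defs
begin

text \<open>
  Write \<open>f p q\<close> for the largest order of a graph with clique number at most \<open>p\<close> and independence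
  number at most \<open>q\<close>, so that \<open>f p q = R(p + 1, q + 1) - 1\<close>. In a feasible colouring, the vertices
  of singleton colour \<open>i\<close> span only edges of the other two colours, and all edges between two
  such classes have the third colour. Hence the clique numbers of a colour in the two classes
  where it occurs add up to at most \<open>a - 1\<close>, for the corresponding \<open>a\<close>. A colouring with at least
  two nonempty classes is therefore smaller than \<open>f (a2 - 1) (a3 - 1)\<close> because \<open>f\<close> is superadditive
  in each argument, \<open>f k p + f k q < f k (p + q)\<close> for \<open>k \<ge> 2\<close> and \<open>p, q \<ge> 1\<close>, while a single class
  attains this value.
\<close>

section \<open>Graphs with bounded clique and independence number, and Ramsey numbers\<close>

text \<open>\<open>pairwise\<close> looks at distinct points only, so the values of \<open>E\<close>
  on the diagonal do not matter and the complement is plain negation.\<close>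

definition ramsey_graph :: "'a set \<Rightarrow> ('a \<Rightarrow> 'a \<Rightarrow> bool) \<Rightarrow> nat \<Rightarrow> nat \<Rightarrow> bool" where
  "ramsey_graph V E p q \<longleftrightarrow> finite V \<and> symp E \<and>
     (\<forall>K\<subseteq>V. pairwise E K \<longrightarrow> card K \<le> p) \<and>
     (\<forall>K\<subseteq>V. pairwise (\<lambda>x y. \<not> E x y) K \<longrightarrow> card K \<le> q)"

definition realizable :: "nat \<Rightarrow> nat \<Rightarrow> nat \<Rightarrow> bool" where
  "realizable n p q \<longleftrightarrow> (\<exists>E :: nat \<Rightarrow> nat \<Rightarrow> bool. ramsey_graph {..<n} E p q)"

lemma ramsey_graph_pullback:
  assumes "ramsey_graph V E p q" "inj_on f W" "f ` W \<subseteq> V"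
  shows "ramsey_graph W (\<lambda>x y. E (f x) (f y)) p q"
proof -
  have fin: "finite W"
    using assms by (meson finite_imageD finite_subset ramsey_graph_def)
  have img: "card K = card (f ` K)" "f ` K \<subseteq> V" if "K \<subseteq> W" for K
    using that assms(2,3) by (auto simp: card_image inj_on_subset)
  have pw: "pairwise R (f ` K)" if "pairwise (\<lambda>x y. R (f x) (f y)) K" for R K
    using that by (auto simp: pairwise_def)
  show ?thesis
    unfolding ramsey_graph_def
  proof (intro conjI allI impI)
    show "symp (\<lambda>x y. E (f x) (f y))"
      using assms(1) by (simp add: ramsey_graph_def symp_def)
  next
    fix K assume "K \<subseteq> W" "pairwise (\<lambda>x y. E (f x) (f y)) K"
    then show "card K \<le> p"
      using assms(1) img[of K] pw[of E K] by (simp add: ramsey_graph_def)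
  next
    fix K assume "K \<subseteq> W" "pairwise (\<lambda>x y. \<not> E (f x) (f y)) K"
    then show "card K \<le> q"
      using assms(1) img[of K] pw[of "\<lambda>x y. \<not> E x y" K] by (simp add: ramsey_graph_def)
  qed (rule fin)
qed

text \<open>This frees constructions to use any vertex type, such as sums and options: an injection
  from \<open>{..<n}\<close> brings them back to natural numbers.\<close>

lemma ramsey_graph_imp_realizable:
  assumes "ramsey_graph V E p q" "n \<le> card V"
  shows "realizable n p q"
proof -
  obtain f where "inj_on f {..<n}" "f ` {..<n} \<subseteq> V"
    using assms card_le_inj[of "{..<n}" V] by (auto simp: ramsey_graph_def)
  then show ?thesis
    using ramsey_graph_pullback[OF assms(1)] unfolding realizable_def by blast
qed

lemma realizable_le: "realizable n p q \<Longrightarrow> m \<le> n \<Longrightarrow> realizable m p q"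
  unfolding realizable_def[of n] by (auto intro: ramsey_graph_imp_realizable)

lemma realizable_mono:
  assumes "realizable n p q" "p \<le> p'" "q \<le> q'"
  shows "realizable n p' q'"
  using assms unfolding realizable_def ramsey_graph_def by (meson le_trans)

text \<open>Complementation exchanges cliques and independent sets. Results that add up the second
  bound thereby apply to the first one as well.\<close>

lemma realizable_commute:
  assumes "realizable n p q"
  shows "realizable n q p"
proof -
  obtain E where "ramsey_graph {..<n} E p q"
    using assms unfolding realizable_def by blast
  then have "ramsey_graph {..<n} (\<lambda>x y. \<not> E x y) q p"
    by (auto simp: ramsey_graph_def symp_def)
  then show ?thesis
    unfolding realizable_def by blast
qed

text \<open>Edges become colour 0 and non-edges colour 1; a clique of size at most \<open>p\<close>
  means no homogeneous set of size \<open>Suc p\<close>, and likewise for \<open>q\<close>.\<close>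

lemma realizable_iff_not_partn:
  "realizable n p q \<longleftrightarrow> \<not> partn_lst {..<n} [Suc p, Suc q] 2"
proof
  assume "realizable n p q"
  then obtain E where E: "ramsey_graph {..<n} E p q"
    unfolding realizable_def by blast
  \<comment> \<open>Colours are attached to two-element sets rather than ordered pairs; symmetry of
    \<open>E\<close> makes the choice of order irrelevant.\<close>
  define f where "f e = (if \<exists>x y. e = {x, y} \<and> E x y then 0 else 1::nat)" for e
  have f0: "f {x, y} = 0 \<longleftrightarrow> E x y" for x y
  proof -
    have "E y x \<longleftrightarrow> E x y" for x y
      using E by (auto simp: ramsey_graph_def elim: sympE)
    then have "(\<exists>a b. {x, y} = {a, b} \<and> E a b) \<longleftrightarrow> E x y"
      by (metis doubleton_eq_iff)
    then show ?thesis
      by (simp only: f_def) simp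
  qed
  have f1: "f {x, y} = 1 \<longleftrightarrow> \<not> E x y" for x y
    using f0[of x y] unfolding f_def by presburger
  show "\<not> partn_lst {..<n} [Suc p, Suc q] 2"
  proof
    assume "partn_lst {..<n} [Suc p, Suc q] 2"
    moreover have "f \<in> nsets {..<n} 2 \<rightarrow> {..<length [Suc p, Suc q]}"
      by (auto simp: f_def)
    ultimately obtain i H where i: "i < 2" and H: "H \<in> nsets {..<n} ([Suc p, Suc q] ! i)"
      and fi: "f ` nsets H 2 \<subseteq> {i}"
      by (auto simp: partn_lst_def monochromatic_def numeral_2_eq_2)
    have "f {x, y} = i" if "x \<in> H" "y \<in> H" "x \<noteq> y" for x y
      using fi that by (simp add: image_subset_iff)
    then have "i = 0 \<Longrightarrow> pairwise E H" "i = 1 \<Longrightarrow> pairwise (\<lambda>x y. \<not> E x y) H"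
      by (simp_all add: pairwise_def f0 f1 del: One_nat_def)
    moreover have "H \<subseteq> {..<n}" "card H = [Suc p, Suc q] ! i"
      using H by (auto simp: nsets_def)
    moreover have "card H \<le> p" if "pairwise E H" "H \<subseteq> {..<n}"
      using E that unfolding ramsey_graph_def by blast
    moreover have "card H \<le> q" if "pairwise (\<lambda>x y. \<not> E x y) H" "H \<subseteq> {..<n}"
      using E that unfolding ramsey_graph_def by blast
    ultimately show False
      using less_2_cases[OF i] by (elim disjE) simp_all
  qed
next
  assume "\<not> partn_lst {..<n} [Suc p, Suc q] 2"
  then obtain f where f: "f \<in> nsets {..<n} 2 \<rightarrow> {..<2}"
    and no: "\<And>i. i < 2 \<Longrightarrow> \<not> monochromatic {..<n} ([Suc p, Suc q] ! i) 2 f i"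
    by (auto simp: partn_lst_def numeral_2_eq_2)
  have bound: "card K \<le> s"
    if "i < 2" "[Suc p, Suc q] ! i = Suc s" "K \<subseteq> {..<n}" "pairwise (\<lambda>x y. f {x, y} = i) K" for i s K
  proof (rule ccontr)
    assume "\<not> card K \<le> s"
    \<comment> \<open>\<open>monochromatic\<close> asks for a set of exact size, so a larger one is
      trimmed.\<close>
    then obtain L where L: "L \<subseteq> K" "card L = Suc s" "finite L"
      by (metis not_less_eq_eq obtain_subset_with_card_n)
    then have "L \<in> nsets {..<n} ([Suc p, Suc q] ! i)"
      using that by (auto simp: nsets_def)
    moreover have "f ` nsets L 2 \<subseteq> {i}"
      using that(4) L(1) by (auto elim!: nsets2_E simp: pairwise_def subset_iff)
    ultimately show False
      using no[OF that(1)] unfolding monochromatic_def by blast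
  qed
  have "ramsey_graph {..<n} (\<lambda>x y. f {x, y} = 0) p q"
    unfolding ramsey_graph_def
  proof (intro conjI allI impI)
    show "symp (\<lambda>x y. f {x, y} = 0)"
      by (auto simp: symp_def insert_commute)
  next
    fix K assume "K \<subseteq> {..<n}" "pairwise (\<lambda>x y. f {x, y} = 0) K"
    then show "card K \<le> p"
      using bound[of 0] by simp
  next
    fix K assume K: "K \<subseteq> {..<n}" "pairwise (\<lambda>x y. f {x, y} \<noteq> 0) K"
    have "f {x, y} = 1" if "x \<in> K" "y \<in> K" "x \<noteq> y" for x y
    proof -
      have "{x, y} \<in> nsets {..<n} 2"
        using that K by auto
      then have "f {x, y} < 2"
        using f by blast
      moreover have "f {x, y} \<noteq> 0"
        using K(2) that unfolding pairwise_def by blast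
      ultimately show ?thesis
        by linarith
    qed
    then have "pairwise (\<lambda>x y. f {x, y} = 1) K"
      unfolding pairwise_def by blast
    then show "card K \<le> q"
      using bound[of 1 q K] K(1) by simp
  qed simp
  then show "realizable n p q"
    unfolding realizable_def by blast
qed

text \<open>The partition relation holds for some \<open>n\<close> by Ramsey's theorem and persists
  for larger \<open>n\<close>, so it fails exactly below its least instance.\<close>

lemma realizable_iff_less_ramsey_number:
  "realizable n p q \<longleftrightarrow> n < ramsey_number (Suc p) (Suc q)"
proof -
  let ?P = "\<lambda>n::nat. partn_lst {..<n} [Suc p, Suc q] 2"
  have "\<exists>n. ?P n"
    by (rule ramsey_full)
  then have "?P (ramsey_number (Suc p) (Suc q))"
    unfolding ramsey_number_def by (rule LeastI_ex)
  then have "?P n \<longleftrightarrow> ramsey_number (Suc p) (Suc q) \<le> n"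
    unfolding ramsey_number_def using partn_lst_greater_resource Least_le[of ?P] by blast
  then show ?thesis
    by (simp add: realizable_iff_not_partn not_le)
qed

section \<open>Superadditivity and the merging of three classes\<close>

lemma card_subset_Plus:
  assumes "K \<subseteq> Inl ` V \<union> Inr ` W" "finite V" "finite W"
  shows "card K = card (Inl -` K) + card (Inr -` K)"
proof -
  have K: "K = Inl ` (Inl -` K) \<union> Inr ` (Inr -` K)"
    using assms(1) by auto
  have "finite (Inl -` K)" "finite (Inr -` K)"
    using assms by (auto intro!: finite_subset[of "Inl -` K" V] finite_subset[of "Inr -` K" W])
  then have "card (Inl ` (Inl -` K) \<union> Inr ` (Inr -` K)) = card (Inl -` K) + card (Inr -` K)"
    by (subst card_Un_disjoint) (auto simp: card_image simp del: image_vimage_eq)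
  with K show ?thesis
    by simp
qed

text \<open>In a disjoint union a clique stays on one side, while independent sets of the two sides
  add up.\<close>

lemma realizable_add:
  assumes "realizable m k p" "realizable n k q"
  shows "realizable (m + n) k (p + q)"
proof -
  obtain E F where E: "ramsey_graph {..<m} E k p" and F: "ramsey_graph {..<n} F k q"
    using assms unfolding realizable_def by blast
  define D where "D s t = (case (s, t) of
    (Inl x, Inl y) \<Rightarrow> E x y | (Inr x, Inr y) \<Rightarrow> F x y | _ \<Rightarrow> False)" for s t
  have D [simp]: "D (Inl x) (Inl y) = E x y" "D (Inr a) (Inr b) = F a b"
    "\<not> D (Inl x) (Inr b)" "\<not> D (Inr a) (Inl y)" for x y a b
    by (simp_all add: D_def)
  let ?V = "Inl ` {..<m} \<union> Inr ` {..<n}"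
  have split: "card K = card (Inl -` K) + card (Inr -` K)" "Inl -` K \<subseteq> {..<m}" "Inr -` K \<subseteq> {..<n}"
    if "K \<subseteq> ?V" for K
    using card_subset_Plus[OF that] that by auto
  have "ramsey_graph ?V D k (p + q)"
    unfolding ramsey_graph_def
  proof (intro conjI allI impI)
    show "symp D"
      using E F unfolding ramsey_graph_def symp_def D_def by (auto split: sum.splits)
  next
    fix K assume K: "K \<subseteq> ?V" "pairwise D K"
    then have "Inl -` K = {} \<or> Inr -` K = {}"
      by (force simp: pairwise_def)
    moreover have "pairwise E (Inl -` K)" "pairwise F (Inr -` K)"
      using K(2) by (simp_all add: pairwise_def flip: D(1,2))
    then have "card (Inl -` K) \<le> k" "card (Inr -` K) \<le> k"
      using E F split[OF K(1)] by (auto simp: ramsey_graph_def)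
    ultimately show "card K \<le> k"
      using split(1)[OF K(1)] by auto
  next
    fix K assume K: "K \<subseteq> ?V" "pairwise (\<lambda>x y. \<not> D x y) K"
    have "pairwise (\<lambda>x y. \<not> E x y) (Inl -` K)" "pairwise (\<lambda>x y. \<not> F x y) (Inr -` K)"
      using K(2) by (simp_all add: pairwise_def flip: D(1,2))
    then have "card (Inl -` K) \<le> p" "card (Inr -` K) \<le> q"
      using E F split[OF K(1)] by (auto simp: ramsey_graph_def)
    then show "card K \<le> p + q"
      using split(1)[OF K(1)] by auto
  qed auto
  moreover have "card ?V = m + n"
    by (subst card_Un_disjoint) (auto simp: card_image)
  ultimately show ?thesis
    by (intro ramsey_graph_imp_realizable) auto
qed

text \<open>
  Given graphs \<open>E\<close> and \<open>F\<close>, a vertex \<open>u\<close> of \<open>E\<close> and a vertex \<open>v\<close> of \<open>F\<close>, take the disjoint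
  union, join \<open>u\<close> to the neighbours of \<open>v\<close>, and add a new vertex (\<open>None\<close>) joined to \<open>v\<close> and to
  the neighbours of \<open>u\<close>. An independent set containing the new vertex loses a vertex on one of
  the two sides: \<open>v\<close> could be added to it if it contains \<open>u\<close>, and \<open>u\<close> otherwise.
\<close>

lemma realizable_add_strict:
  assumes "realizable m k p" "realizable n k q" "0 < m" "0 < n" "2 \<le> k"
  shows "realizable (Suc (m + n)) k (p + q)"
proof -
  obtain E F where E: "ramsey_graph {..<m} E k p" and F: "ramsey_graph {..<n} F k q"
    using assms unfolding realizable_def by blast
  have symE: "E x y \<longleftrightarrow> E y x" and symF: "F x y \<longleftrightarrow> F y x" for x y
    using E F by (auto simp: ramsey_graph_def elim: sympE)
  \<comment> \<open>Any two vertices would do; 0 is available on both sides because \<open>m\<close>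
    and \<open>n\<close> are positive.\<close>
  define u v :: nat where "u = 0" and "v = 0"
  have uv: "u < m" "v < n"
    using assms by (auto simp: u_def v_def)
  define D where "D s t = (case (s, t) of
      (Some (Inl x), Some (Inl y)) \<Rightarrow> E x y
    | (Some (Inr x), Some (Inr y)) \<Rightarrow> F x y
    | (Some (Inl x), Some (Inr y)) \<Rightarrow> x = u \<and> y \<noteq> v \<and> F v y
    | (Some (Inr y), Some (Inl x)) \<Rightarrow> x = u \<and> y \<noteq> v \<and> F v y
    | (None, Some (Inl x)) \<Rightarrow> x \<noteq> u \<and> E u x
    | (Some (Inl x), None) \<Rightarrow> x \<noteq> u \<and> E u x
    | (None, Some (Inr y)) \<Rightarrow> y = v
    | (Some (Inr y), None) \<Rightarrow> y = v
    | (None, None) \<Rightarrow> False)" for s t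
  have D: "D (Some (Inl x)) (Some (Inl y)) = E x y"
    "D (Some (Inr a)) (Some (Inr b)) = F a b"
    "D (Some (Inl x)) (Some (Inr b)) = (x = u \<and> b \<noteq> v \<and> F v b)"
    "D None (Some (Inl x)) = (x \<noteq> u \<and> E u x)"
    "D None (Some (Inr b)) = (b = v)" for x y a b
    by (simp_all add: D_def)
  let ?V = "insert None (Some ` (Inl ` {..<m} \<union> Inr ` {..<n}))"
  define A B where "A K = {x. Some (Inl x) \<in> K}" and "B K = {y. Some (Inr y) \<in> K}"
    for K :: "(nat + nat) option set"
  have sub: "A K \<subseteq> {..<m}" "B K \<subseteq> {..<n}" "finite (A K)" "finite (B K)" if "K \<subseteq> ?V" for K
  proof -
    show "A K \<subseteq> {..<m}" "B K \<subseteq> {..<n}"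
      using that by (auto simp: A_def B_def)
    then show "finite (A K)" "finite (B K)"
      by (simp_all add: finite_subset[OF _ finite_lessThan])
  qed
  have card: "card K = card (A K) + card (B K) + (if None \<in> K then 1 else 0)"
    if "K \<subseteq> ?V" for K
  proof -
    have "finite K"
      using that by (rule finite_subset) auto
    have "K - {None} = Some ` (Some -` K)"
    proof (rule set_eqI)
      show "s \<in> K - {None} \<longleftrightarrow> s \<in> Some ` (Some -` K)" for s
        by (cases s) auto
    qed
    then have "card (K - {None}) = card (Some -` K)"
      by (simp add: card_image del: image_vimage_eq)
    also have "\<dots> = card (A K) + card (B K)"
    proof -
      have "Some -` K \<subseteq> Inl ` {..<m} \<union> Inr ` {..<n}"
        using that by blast
      moreover have "Inl -` Some -` K = A K" "Inr -` Some -` K = B K"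
        by (auto simp: A_def B_def)
      ultimately show ?thesis
        using card_subset_Plus[of "Some -` K" "{..<m}" "{..<n}"] by simp
    qed
    finally show ?thesis
      using \<open>finite K\<close> card_Suc_Diff1[of K None] by (cases "None \<in> K") simp_all
  qed
  have E_clique: "card L \<le> k" if "L \<subseteq> {..<m}" "pairwise E L" for L
    using E that by (simp add: ramsey_graph_def)
  have E_indep: "card L \<le> p" if "L \<subseteq> {..<m}" "pairwise (\<lambda>x y. \<not> E x y) L" for L
    using E that by (simp add: ramsey_graph_def)
  have F_clique: "card L \<le> k" if "L \<subseteq> {..<n}" "pairwise F L" for L
    using F that by (simp add: ramsey_graph_def)
  have F_indep: "card L \<le> q" if "L \<subseteq> {..<n}" "pairwise (\<lambda>x y. \<not> F x y) L" for L
    using F that by (simp add: ramsey_graph_def)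
  have "ramsey_graph ?V D k (p + q)"
    unfolding ramsey_graph_def
  proof (intro conjI allI impI)
    show "symp D"
    proof (rule sympI)
      show "D t s" if "D s t" for s t
        using that symE symF by (cases s; cases t) (auto simp: D_def split: sum.splits)
    qed
  next
    fix K assume K: "K \<subseteq> ?V" "pairwise D K"
    note subK = sub[OF K(1)]
    have pw: "D s t" if "s \<in> K" "t \<in> K" "s \<noteq> t" for s t
      using K(2) that by (simp add: pairwise_def)
    have A: "pairwise E (A K)" and B: "pairwise F (B K)"
      using pw by (auto simp: pairwise_def A_def B_def simp flip: D(1,2))
    have AB: "x = u \<and> y \<noteq> v \<and> F v y" if "x \<in> A K" "y \<in> B K" for x y
      using pw[of "Some (Inl x)" "Some (Inr y)"] that by (simp add: A_def B_def D)
    have NA: "x \<noteq> u \<and> E u x" if "None \<in> K" "x \<in> A K" for x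
      using pw[of None "Some (Inl x)"] that by (simp add: A_def D)
    have NB: "y = v" if "None \<in> K" "y \<in> B K" for y
      using pw[of None "Some (Inr y)"] that by (simp add: B_def D)
    show "card K \<le> k"
    proof (cases "None \<in> K")
      case True
      show ?thesis
      proof (cases "B K = {}")
        case B0: True
        \<comment> \<open>The new vertex is exchanged for \<open>u\<close>, which has the same
          neighbours in the first graph and is not itself in the clique.\<close>
        have "pairwise E (insert u (A K))" "u \<notin> A K"
          using A NA[OF True] symE by (auto simp: pairwise_insert)
        then show ?thesis
          using E_clique[of "insert u (A K)"] subK uv card[OF K(1)] B0 by simp
      next
        case False
        \<comment> \<open>A vertex of \<open>A K\<close> would have to be \<open>u\<close>, which is
          not joined to \<open>v\<close>. So \<open>K\<close> consists of the new vertex and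
          \<open>v\<close>, and \<open>2 \<le> k\<close> enters here.\<close>
        then have "A K = {}" "B K = {v}"
          using NB[OF True] AB by blast+
        then show ?thesis
          using card[OF K(1)] True assms(5) by simp
      qed
    next
      case False
      show ?thesis
      proof (cases "A K = {} \<or> B K = {}")
        case True
        then show ?thesis
          using card[OF K(1)] False E_clique[OF subK(1) A] F_clique[OF subK(2) B] by auto
      next
        case AB0: False
        \<comment> \<open>A clique across the two sides meets the first one only in
          \<open>u\<close>, which can be exchanged for \<open>v\<close>.\<close>
        then have "A K = {u}"
          using AB by blast
        moreover have "pairwise F (insert v (B K))" "v \<notin> B K"
          using AB AB0 B symF by (auto simp: pairwise_insert)
        ultimately show ?thesis
          using F_clique[of "insert v (B K)"] subK uv card[OF K(1)] False by simp
      qed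
    qed
  next
    fix K assume K: "K \<subseteq> ?V" "pairwise (\<lambda>x y. \<not> D x y) K"
    note subK = sub[OF K(1)]
    have pw: "\<not> D s t" if "s \<in> K" "t \<in> K" "s \<noteq> t" for s t
      using K(2) that by (simp add: pairwise_def)
    have A: "pairwise (\<lambda>x y. \<not> E x y) (A K)" and B: "pairwise (\<lambda>x y. \<not> F x y) (B K)"
      using pw by (auto simp: pairwise_def A_def B_def simp flip: D(1,2))
    show "card K \<le> p + q"
    proof (cases "None \<in> K")
      case True
      show ?thesis
      proof (cases "u \<in> A K")
        case u: True
        have "v \<notin> B K"
          using pw[of None "Some (Inr v)"] True by (auto simp: B_def D)
        moreover have "\<not> F v y" if "y \<in> B K" "y \<noteq> v" for y
          using pw[of "Some (Inl u)" "Some (Inr y)"] u that by (auto simp: A_def B_def D)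
        ultimately have "pairwise (\<lambda>x y. \<not> F x y) (insert v (B K))" "v \<notin> B K"
          using B symF by (auto simp: pairwise_insert)
        then show ?thesis
          using F_indep[of "insert v (B K)"] E_indep[OF subK(1) A] subK uv card[OF K(1)] by simp
      next
        case u: False
        have "\<not> E u x" if "x \<in> A K" for x
          using pw[of None "Some (Inl x)"] u that True by (auto simp: A_def D)
        then have "pairwise (\<lambda>x y. \<not> E x y) (insert u (A K))"
          using A symE by (auto simp: pairwise_insert)
        then show ?thesis
          using E_indep[of "insert u (A K)"] F_indep[OF subK(2) B] subK uv card[OF K(1)] u by simp
      qed
    next
      case False
      then show ?thesis
        using E_indep[OF subK(1) A] F_indep[OF subK(2) B] card[OF K(1)] by simp
    qed
  qed auto
  moreover have "card ?V = Suc (m + n)"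
    by (subst card_insert_disjoint, force, force, subst card_image, simp, subst card_Un_disjoint)
      (auto simp: card_image)
  ultimately show ?thesis
    by (intro ramsey_graph_imp_realizable) auto
qed

text \<open>
  Here \<open>x\<close>, \<open>y\<close>, \<open>z\<close> are the clique numbers of the classes of singleton colours 1, 2, 3, with
  subscripts naming the edge colour. If all classes are nonempty, the third one can be
  combined with the first when \<open>z1 \<le> x3\<close> and with the second when \<open>z2 \<le> y3\<close>; otherwise
  the sum is at most \<open>f P z1 + f P (P - z1)\<close>.
\<close>

lemma realizable_merge_three:
  assumes r1: "realizable n1 x2 x3" and r2: "realizable n2 y1 y3" and r3: "realizable n3 z1 z2"
    and le: "y1 + z1 \<le> P" "x2 + z2 \<le> P" "x3 + y3 \<le> Q" "P \<le> Q" "2 \<le> P"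
    and two: "0 < n1 \<and> 0 < n2 \<or> 0 < n1 \<and> 0 < n3 \<or> 0 < n2 \<and> 0 < n3"
  shows "realizable (Suc (n1 + n2 + n3)) P Q"
proof -
  have strict: "realizable (Suc (n1 + n2 + n3)) P Q"
    if "realizable m P s" "realizable n P t" "0 < m" "0 < n" "s + t \<le> Q" "m + n = n1 + n2 + n3"
    for m n s t
    using realizable_mono[OF realizable_add_strict[OF that(1-4)], of P Q] le that by simp
  \<comment> \<open>The last three cases include \<open>n3 = 0\<close>: \<open>strict\<close> only
    asks that the two merged parts be nonempty.\<close>
  consider "n1 = 0" | "n2 = 0" | "0 < n1" "0 < n2" "z1 \<le> x3" | "0 < n1" "0 < n2" "z2 \<le> y3"
    | "0 < n1" "0 < n2" "x3 \<le> z1" "y3 \<le> z2"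
    by linarith
  then show ?thesis
  proof cases
    case 1
    \<comment> \<open>The two remaining classes are joined in colour 1, so the bounds for that
      colour are added, to at most \<open>P\<close>. The other bounds fit below \<open>Q\<close>,
      for \<open>z2\<close> by way of \<open>z2 \<le> P \<le> Q\<close>.\<close>
    have "realizable n2 Q y1" "realizable n3 Q z1"
      using realizable_mono[OF realizable_commute[OF r2]] realizable_mono[OF realizable_commute[OF r3]] le
      by simp_all
    then have "realizable (Suc (n2 + n3)) Q (y1 + z1)"
      using 1 two le by (intro realizable_add_strict) auto
    then show ?thesis
      using realizable_mono[OF realizable_commute, of _ Q "y1 + z1" P Q] 1 le by simp
  next
    case 2
    have "realizable n1 Q x2" "realizable n3 Q z2"
      using realizable_mono[OF realizable_commute[OF r1]] realizable_mono[OF r3] le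
      by simp_all
    then have "realizable (Suc (n1 + n3)) Q (x2 + z2)"
      using 2 two le by (intro realizable_add_strict) auto
    then show ?thesis
      using realizable_mono[OF realizable_commute, of _ Q "x2 + z2" P Q] 2 le by simp
  next
    case 3
    have "realizable (n1 + n3) x3 (x2 + z2)"
      using realizable_commute[OF r1] realizable_mono[OF r3 3(3) order_refl] by (rule realizable_add)
    then have "realizable (n1 + n3) P x3"
      using realizable_mono[OF realizable_commute] le by blast
    moreover have "realizable n2 P y3"
      using realizable_mono[OF r2] le by simp
    ultimately show ?thesis
      using 3 le by (intro strict[of "n1 + n3" x3 n2 y3]) auto
  next
    case 4
    have "realizable (n2 + n3) y3 (y1 + z1)"
      using realizable_commute[OF r2] realizable_mono[OF realizable_commute[OF r3] 4(3) order_refl]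
      by (rule realizable_add)
    then have "realizable (n2 + n3) P y3"
      using realizable_mono[OF realizable_commute] le by blast
    moreover have "realizable n1 P x3"
      using realizable_mono[OF r1] le by simp
    ultimately show ?thesis
      using 4 le by (intro strict[of n1 x3 "n2 + n3" y3]) auto
  next
    case 5
    have "realizable (n1 + n3) z1 (x2 + z2)"
      using realizable_mono[OF realizable_commute[OF r1] 5(3) order_refl] r3 by (rule realizable_add)
    then have "realizable (n1 + n3) P z1"
      using realizable_mono[OF realizable_commute] le by blast
    \<comment> \<open>Here \<open>y3 \<le> z2 \<le> P\<close>, so the roles of \<open>y1\<close> and
      \<open>y3\<close> can be swapped; the added bounds satisfy
      \<open>z1 + y1 \<le> P \<le> Q\<close>.\<close>
    moreover have "realizable n2 P y1"
      using realizable_mono[OF realizable_commute[OF r2]] 5 le by simp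
    ultimately show ?thesis
      using 5 le by (intro strict[of "n1 + n3" z1 n2 y1]) auto
  qed
qed

section \<open>Upper bound: from feasible colourings to Ramsey graphs\<close>

definition clique_number :: "('a \<Rightarrow> 'a \<Rightarrow> bool) \<Rightarrow> 'a set \<Rightarrow> nat" where
  "clique_number R V = Max (card ` {K. K \<subseteq> V \<and> pairwise R K})"

lemma card_le_clique_number:
  assumes "finite V" "K \<subseteq> V" "pairwise R K"
  shows "card K \<le> clique_number R V"
  unfolding clique_number_def using assms by (intro Max_ge) auto

lemma clique_number_attained:
  assumes "finite V"
  obtains K where "K \<subseteq> V" "pairwise R K" "card K = clique_number R V"
proof -
  have "{} \<in> {K. K \<subseteq> V \<and> pairwise R K}"
    by simp
  then have "clique_number R V \<in> card ` {K. K \<subseteq> V \<and> pairwise R K}"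
    unfolding clique_number_def using assms by (intro Max_in) (simp, blast)
  then show thesis
    using that by auto
qed

text \<open>Between completely joined sets, the union of a largest clique from each is again a
  clique.\<close>

lemma clique_number_add_le:
  assumes "finite V" "finite W" "V \<inter> W = {}" "\<And>x y. x \<in> V \<Longrightarrow> y \<in> W \<Longrightarrow> R x y \<and> R y x"
    and bound: "\<And>K. K \<subseteq> V \<union> W \<Longrightarrow> pairwise R K \<Longrightarrow> card K \<le> s"
  shows "clique_number R V + clique_number R W \<le> s"
proof -
  obtain K where K: "K \<subseteq> V" "pairwise R K" "card K = clique_number R V"
    using clique_number_attained[OF assms(1)] .
  obtain L where L: "L \<subseteq> W" "pairwise R L" "card L = clique_number R W"
    using clique_number_attained[OF assms(2)] .
  have "pairwise R (K \<union> L)"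
    using K L assms(4) by (auto simp: pairwise_def subset_iff)
  then have "card (K \<union> L) \<le> s"
    using K L by (intro bound) auto
  moreover have "card (K \<union> L) = card K + card L"
    using K L assms by (intro card_Un_disjoint) (auto intro: finite_subset)
  ultimately show ?thesis
    using K L by simp
qed

text \<open>Colour graphs have no loops, so a homomorphism from a complete graph is injective and
  its image is a clique.\<close>

lemma ex_hom_complete_graph_iff:
  "(\<exists>f. graph_hom (complete_graph a) (colour_graph r \<xi> i) f) \<longleftrightarrow>
   (\<exists>K\<subseteq>{..<r}. card K = a \<and> pairwise (\<lambda>x y. \<xi> {x, y} = i) K)"
proof
  assume "\<exists>f. graph_hom (complete_graph a) (colour_graph r \<xi> i) f"
  then obtain f where f: "f ` {..<a} \<subseteq> {..<r}"
    and edge: "\<And>e. e \<in> [{..<a}]\<^bsup>2\<^esup> \<Longrightarrow> f ` e \<in> [{..<r}]\<^bsup>2\<^esup> \<and> \<xi> (f ` e) = i"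
    by (auto simp: graph_hom_def complete_graph_def colour_graph_def)
  have edge2: "f x \<noteq> f y \<and> \<xi> {f x, f y} = i" if "x < a" "y < a" "x \<noteq> y" for x y
    using edge[of "{x, y}"] that by simp
  then have "inj_on f {..<a}"
    by (auto simp: inj_on_def)
  then have "card (f ` {..<a}) = a"
    by (simp add: card_image)
  moreover have "pairwise (\<lambda>x y. \<xi> {x, y} = i) (f ` {..<a})"
    using edge2 by (force simp: pairwise_def)
  ultimately show "\<exists>K\<subseteq>{..<r}. card K = a \<and> pairwise (\<lambda>x y. \<xi> {x, y} = i) K"
    using f by blast
next
  assume "\<exists>K\<subseteq>{..<r}. card K = a \<and> pairwise (\<lambda>x y. \<xi> {x, y} = i) K"
  then obtain K where K: "K \<subseteq> {..<r}" "card K = a" "pairwise (\<lambda>x y. \<xi> {x, y} = i) K"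
    by blast
  then obtain f where f: "bij_betw f {..<a} K"
    using ex_bij_betw_nat_finite[of K] finite_subset[OF K(1)] by (auto simp: atLeast0LessThan)
  have "f ` e \<in> [{..<r}]\<^bsup>2\<^esup> \<and> \<xi> (f ` e) = i" if ine: "e \<in> [{..<a}]\<^bsup>2\<^esup>" for e
  proof -
    obtain x y where e: "e = {x, y}" "x < a" "y < a" "x \<noteq> y"
      using ine by (auto elim: nsets2_E)
    then have "f x \<in> K" "f y \<in> K" "f x \<noteq> f y"
      using f by (auto simp: bij_betw_def inj_on_def)
    then show ?thesis
      using e K by (auto simp: pairwise_def)
  qed
  moreover have "f \<in> {..<a} \<rightarrow> {..<r}"
    using f K(1) by (auto simp: bij_betw_def)
  ultimately show "\<exists>f. graph_hom (complete_graph a) (colour_graph r \<xi> i) f"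
    unfolding graph_hom_def complete_graph_def colour_graph_def by auto
qed

text \<open>The first conclusion bounds the order of feasible colourings. The second gains one
  vertex when the singleton colours differ, which rules out such colourings at the maximal
  order.\<close>

lemma feasible_imp_realizable:
  assumes "3 \<le> a1" "a1 \<le> a2" "a2 \<le> a3"
    and feas: "feasible [complete_graph a1, complete_graph a2, complete_graph a3] r \<xi>"
  shows "realizable r (a2 - 1) (a3 - 1)"
    and "x < r \<Longrightarrow> y < r \<Longrightarrow> \<xi> {x} \<noteq> \<xi> {y} \<Longrightarrow> realizable (Suc r) (a2 - 1) (a3 - 1)"
proof -
  define R where "R i x y \<longleftrightarrow> \<xi> {x, y} = i" for i x y
  define V where "V i = {x. x < r \<and> \<xi> {x} = i}" for i
  define c where "c i j = clique_number (R j) (V i)" for i j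
  define a where "a = [a1, a2, a3]"
  have finV: "finite (V i)" for i
    by (simp add: V_def)
  have Hs: "[complete_graph a1, complete_graph a2, complete_graph a3] ! i = complete_graph (a ! i)"
    if i: "i < 3" for i
  proof -
    consider "i = 0" | "i = 1" | "i = 2"
      using i by linarith
    then show ?thesis
      by cases (simp_all add: a_def)
  qed
  have "\<xi> \<in> subsets_upto2 r \<rightarrow> {..<length [complete_graph a1, complete_graph a2, complete_graph a3]}"
    using feas unfolding feasible_def by (rule conjunct1)
  then have col: "\<xi> X < 3" if "X \<subseteq> {..<r}" "card X \<le> 2" for X
    using that by (auto simp: subsets_upto2_def Pi_iff numeral_3_eq_3)
  have no_hom: "\<nexists>f. graph_hom ([complete_graph a1, complete_graph a2, complete_graph a3] ! i)
      (colour_graph r \<xi> i) f" if "i < 3" for i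
    using feas that unfolding feasible_def by (metis Hs length_Cons list.size(3) numeral_3_eq_3)
  have P2: "\<xi> {x, y} \<noteq> \<xi> {x}" if "x < r" "y < r" "x \<noteq> y" for x y
    using feas that unfolding feasible_def by blast
  have col1: "\<xi> {x} < 3" if "x < r" for x
    using that by (intro col) auto
  have col2: "\<xi> {x, y} < 3" "\<xi> {x, y} \<noteq> \<xi> {x}" "\<xi> {x, y} \<noteq> \<xi> {y}"
    if "x < r" "y < r" "x \<noteq> y" for x y
  proof -
    show "\<xi> {x, y} < 3"
      using that by (intro col) auto
    show "\<xi> {x, y} \<noteq> \<xi> {x}"
      using that by (rule P2)
    have "\<xi> {y, x} \<noteq> \<xi> {y}"
      using that P2[of y x] by simp
    then show "\<xi> {x, y} \<noteq> \<xi> {y}"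
      by (simp add: insert_commute)
  qed
  have bound: "card K \<le> a ! i - 1" if "i < 3" "K \<subseteq> {..<r}" "pairwise (R i) K" for i K
  proof (rule ccontr)
    assume "\<not> card K \<le> a ! i - 1"
    then have "a ! i \<le> card K"
      by simp
    then obtain L where L: "L \<subseteq> K" "card L = a ! i"
      by (metis obtain_subset_with_card_n)
    have "pairwise (\<lambda>x y. \<xi> {x, y} = i) L"
      using that(3) L(1) unfolding R_def by (rule pairwise_subset)
    then have "\<exists>f. graph_hom (complete_graph (a ! i)) (colour_graph r \<xi> i) f"
      using L that(2) unfolding ex_hom_complete_graph_iff by blast
    with no_hom[OF that(1)] show False
      unfolding Hs[OF that(1)] by blast
  qed
  \<comment> \<open>Colour \<open>i\<close> is forbidden on edges inside \<open>V i\<close>, so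
    there the colours \<open>j\<close> and \<open>k\<close> are complementary graphs.\<close>
  have part: "realizable (card (V i)) (c i j) (c i k)" if ijk: "i < 3" "j < 3" "k < 3" "i \<noteq> j" "i \<noteq> k" "j \<noteq> k" for i j k
  proof -
    have third: "l = i \<or> l = j \<or> l = k" if "l < 3" for l
      using ijk that by linarith
    have jk: "R k x y" if "x \<in> V i" "y \<in> V i" "x \<noteq> y" "\<not> R j x y" for x y
      using that col2[of x y] third[of "\<xi> {x, y}"] by (auto simp: V_def R_def)
    have "ramsey_graph (V i) (R j) (c i j) (c i k)"
      unfolding ramsey_graph_def
    proof (intro conjI allI impI)
      show "symp (R j)"
        by (simp add: symp_def R_def insert_commute)
    next
      fix K assume "K \<subseteq> V i" "pairwise (R j) K"
      then show "card K \<le> c i j"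
        unfolding c_def by (intro card_le_clique_number finV)
    next
      fix K assume K: "K \<subseteq> V i" "pairwise (\<lambda>x y. \<not> R j x y) K"
      then have "pairwise (R k) K"
        using jk unfolding pairwise_def by blast
      then show "card K \<le> c i k"
        unfolding c_def using K by (intro card_le_clique_number finV)
    qed (rule finV)
    then show ?thesis
      by (rule ramsey_graph_imp_realizable) simp
  qed
  \<comment> \<open>An edge between \<open>V i\<close> and \<open>V k\<close> avoids both singleton
    colours and so has colour \<open>j\<close>: in this colour the two classes are completely
    joined.\<close>
  have cross: "c i j + c k j \<le> a ! j - 1" if ijk: "i < 3" "j < 3" "k < 3" "i \<noteq> j" "i \<noteq> k" "j \<noteq> k" for i j k
  proof -
    have third: "l = i \<or> l = j \<or> l = k" if "l < 3" for l
      using ijk that by linarith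
    have "R j x y" if "x \<in> V i" "y \<in> V k" for x y
    proof -
      have xy: "x < r" "y < r" "\<xi> {x} = i" "\<xi> {y} = k"
        using that by (auto simp: V_def)
      then show ?thesis
        using col2[of x y] ijk(5) third[of "\<xi> {x, y}"] by (auto simp: R_def)
    qed
    then have "R j x y \<and> R j y x" if "x \<in> V i" "y \<in> V k" for x y
      using that by (simp add: R_def insert_commute)
    moreover have "V i \<union> V k \<subseteq> {..<r}"
      by (auto simp: V_def)
    ultimately show ?thesis
      unfolding c_def
    proof (intro clique_number_add_le finV)
      show "V i \<inter> V k = {}"
        using ijk by (auto simp: V_def)
      show "card K \<le> a ! j - 1" if "K \<subseteq> V i \<union> V k" "pairwise (R j) K" for K
        using bound[OF ijk(2) _ that(2)] that(1) \<open>V i \<union> V k \<subseteq> {..<r}\<close> by blast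
    qed blast+
  qed
  have r: "r = card (V 0) + card (V 1) + card (V 2)"
  proof -
    have "{..<r} = (V 0 \<union> V 1) \<union> V 2"
    proof (rule set_eqI)
      have "\<xi> {x} = 0 \<or> \<xi> {x} = 1 \<or> \<xi> {x} = 2" if "x < r" for x
        using col1[OF that] by linarith
      then show "x \<in> {..<r} \<longleftrightarrow> x \<in> (V 0 \<union> V 1) \<union> V 2" for x
        unfolding V_def by blast
    qed
    then have "card {..<r} = card ((V 0 \<union> V 1) \<union> V 2)"
      by simp
    also have "\<dots> = card (V 0 \<union> V 1) + card (V 2)"
      using finV by (intro card_Un_disjoint) (auto simp: V_def)
    also have "card (V 0 \<union> V 1) = card (V 0) + card (V 1)"
      using finV by (intro card_Un_disjoint) (auto simp: V_def)
    finally show ?thesis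
      by simp
  qed
  have c: "c 1 0 + c 2 0 \<le> a1 - 1" "c 0 1 + c 2 1 \<le> a2 - 1" "c 0 2 + c 1 2 \<le> a3 - 1"
    using cross[of 1 0 2] cross[of 0 1 2] cross[of 0 2 1] by (auto simp: a_def insert_commute)
  \<comment> \<open>With colours shifted to start at 0, these are the hypotheses of
    \<open>realizable_merge_three\<close>: \<open>x2 = c 0 1\<close>, \<open>x3 = c 0 2\<close>,
    \<open>y1 = c 1 0\<close>, and so on.\<close>
  have V: "realizable (card (V 0)) (c 0 1) (c 0 2)" "realizable (card (V 1)) (c 1 0) (c 1 2)"
    "realizable (card (V 2)) (c 2 0) (c 2 1)"
    by (rule part; simp)+
  show two: "realizable (Suc r) (a2 - 1) (a3 - 1)" if "x < r" "y < r" "\<xi> {x} \<noteq> \<xi> {y}" for x y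
  proof -
    have pos: "0 < card (V i) \<longleftrightarrow> (\<exists>z<r. \<xi> {z} = i)" for i
      by (auto simp: card_gt_0_iff V_def)
    have "0 < card (V (\<xi> {x}))" "0 < card (V (\<xi> {y}))"
      using that unfolding pos by blast+
    moreover have "\<xi> {x} \<in> {0, 1, 2}" "\<xi> {y} \<in> {0, 1, 2}"
      using col1[OF that(1)] col1[OF that(2)] by auto
    ultimately have "0 < card (V 0) \<and> 0 < card (V 1) \<or> 0 < card (V 0) \<and> 0 < card (V 2) \<or>
        0 < card (V 1) \<and> 0 < card (V 2)"
      using that(3) by (elim insertE emptyE) simp_all
    then show ?thesis
      using realizable_merge_three[OF V, of "a2 - 1" "a3 - 1"] c assms(1-3) r by simp
  qed
  show "realizable r (a2 - 1) (a3 - 1)"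
  proof (cases "\<exists>x<r. \<exists>y<r. \<xi> {x} \<noteq> \<xi> {y}")
    case True
    then show ?thesis
      using two realizable_le[of "Suc r" _ _ r] by auto
  next
    case False
    \<comment> \<open>One class contains every vertex. The case \<open>r = 0\<close> is separate
      because \<open>\<xi> {0}\<close> is then unconstrained.\<close>
    have "r = 0 \<or> r = card (V (\<xi> {0}))"
    proof (cases "r = 0")
      case False
      with \<open>\<not> (\<exists>x<r. \<exists>y<r. \<xi> {x} \<noteq> \<xi> {y})\<close> have "V (\<xi> {0}) = {..<r}"
        unfolding V_def by blast
      then show ?thesis
        by simp
    qed simp
    moreover have "r > 0 \<Longrightarrow> \<xi> {0} \<in> {0, 1, 2}"
      using col1[of 0] by auto
    ultimately have "r \<le> card (V 0) \<or> r \<le> card (V 1) \<or> r \<le> card (V 2)"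
      by (cases "r = 0") auto
    \<comment> \<open>Each clique number is below its own bound in \<open>c\<close>; the ordering of
      \<open>a1\<close>, \<open>a2\<close>, \<open>a3\<close> lifts these to \<open>a2 - 1\<close>
      and \<open>a3 - 1\<close>.\<close>
    moreover have "realizable (card (V i)) (a2 - 1) (a3 - 1)" if "i \<in> {0, 1, 2}" for i
      using that realizable_mono[OF V(1), of "a2 - 1" "a3 - 1"]
        realizable_mono[OF V(2), of "a2 - 1" "a3 - 1"]
        realizable_mono[OF V(3), of "a2 - 1" "a3 - 1"] c assms(1-3)
      by auto
    ultimately show ?thesis
      using realizable_le by blast
  qed
qed

section \<open>Lower bound and conclusion\<close>

text \<open>All singletons get colour 0, edges of the graph colour 1 and non-edges colour 2. Colour
  0 then has no edges, so it contains no clique of size \<open>a1 \<ge> 2\<close>.\<close>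

lemma realizable_imp_feasible:
  assumes "2 \<le> a1" "0 < a2" "0 < a3" and "realizable r (a2 - 1) (a3 - 1)"
  shows "\<exists>\<xi>. feasible [complete_graph a1, complete_graph a2, complete_graph a3] r \<xi>"
proof -
  obtain E where E: "ramsey_graph {..<r} E (a2 - 1) (a3 - 1)"
    using assms(4) unfolding realizable_def by blast
  then have sym: "E x y \<longleftrightarrow> E y x" for x y
    by (auto simp: ramsey_graph_def elim: sympE)
  define \<xi> :: "nat set \<Rightarrow> nat" where
    "\<xi> X = (if card X = 2 then if \<exists>x y. X = {x, y} \<and> E x y then 1 else 2 else 0)" for X
  have single: "\<xi> {x} = 0" for x
    by (simp add: \<xi>_def)
  have pair: "\<xi> {x, y} = (if E x y then 1 else 2)" if "x \<noteq> y" for x y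
  proof -
    have "(\<exists>a b. {x, y} = {a, b} \<and> E a b) \<longleftrightarrow> E x y"
      using sym by (metis doubleton_eq_iff)
    then show ?thesis
      using that by (simp only: \<xi>_def) simp
  qed
  have "\<nexists>f. graph_hom (complete_graph a1) (colour_graph r \<xi> 0) f"
    unfolding ex_hom_complete_graph_iff
  proof clarify
    fix K assume K: "K \<subseteq> {..<r}" "pairwise (\<lambda>x y. \<xi> {x, y} = 0) K" "a1 = card K"
    then obtain x y where "x \<in> K" "y \<in> K" "x \<noteq> y"
      using assms(1) card_le_Suc0_iff_eq[of K] finite_subset[OF K(1)] by fastforce
    then show False
      using K(2) pair[of x y] by (auto simp: pairwise_def split: if_splits)
  qed
  moreover have "\<nexists>f. graph_hom (complete_graph a2) (colour_graph r \<xi> 1) f"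
    unfolding ex_hom_complete_graph_iff
  proof clarify
    fix K assume K: "K \<subseteq> {..<r}" "pairwise (\<lambda>x y. \<xi> {x, y} = 1) K" "a2 = card K"
    have "pairwise E K"
      using K(2) pair unfolding pairwise_def by (metis numeral_eq_one_iff semiring_norm(85))
    then have "card K \<le> a2 - 1"
      using E K(1) by (simp add: ramsey_graph_def)
    with K(3) assms(2) show False
      by simp
  qed
  moreover have "\<nexists>f. graph_hom (complete_graph a3) (colour_graph r \<xi> 2) f"
    unfolding ex_hom_complete_graph_iff
  proof clarify
    fix K assume K: "K \<subseteq> {..<r}" "pairwise (\<lambda>x y. \<xi> {x, y} = 2) K" "a3 = card K"
    have "pairwise (\<lambda>x y. \<not> E x y) K"
      using K(2) pair unfolding pairwise_def by (metis numeral_eq_one_iff semiring_norm(85))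
    then have "card K \<le> a3 - 1"
      using E K(1) by (simp add: ramsey_graph_def)
    with K(3) assms(3) show False
      by simp
  qed
  moreover have "\<xi> \<in> subsets_upto2 r \<rightarrow> {..<3}"
    by (auto simp: \<xi>_def)
  moreover have "\<xi> {x, y} \<noteq> \<xi> {x}" if "x \<noteq> y" for x y
    using pair[OF that] by (simp add: single)
  ultimately have "feasible [complete_graph a1, complete_graph a2, complete_graph a3] r \<xi>"
    unfolding feasible_def by (simp add: All_less_Suc numeral_2_eq_2 numeral_3_eq_3)
  then show ?thesis
    by blast
qed

theorem theorem1p8:
  fixes a1 a2 a3 :: nat
  assumes "3 \<le> a1" "a1 \<le> a2" "a2 \<le> a3"
  shows "nice [complete_graph a1, complete_graph a2, complete_graph a3] \<and>
         r_star [complete_graph a1, complete_graph a2, complete_graph a3] = ramsey_number a2 a3 - 1"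
proof -
  let ?Hs = "[complete_graph a1, complete_graph a2, complete_graph a3]"
  have real_iff: "realizable n (a2 - 1) (a3 - 1) \<longleftrightarrow> n < ramsey_number a2 a3" for n
    using realizable_iff_less_ramsey_number[of n "a2 - 1" "a3 - 1"] assms by simp
  have feas_iff: "(\<exists>\<xi>. feasible ?Hs n \<xi>) \<longleftrightarrow> n < ramsey_number a2 a3" for n
    using feasible_imp_realizable(1)[OF assms] realizable_imp_feasible[of a1 a2 a3 n] assms
    unfolding real_iff by auto
  \<comment> \<open>The empty graph shows that the Ramsey number is positive, so subtracting 1 is
    not truncated.\<close>
  have "ramsey_graph {..<0::nat} (\<lambda>_ _. False) (a2 - 1) (a3 - 1)"
    by (auto simp: ramsey_graph_def symp_def lessThan_def)
  then have "0 < ramsey_number a2 a3"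
    unfolding real_iff[symmetric] realizable_def by blast
  then have r: "r_star ?Hs = ramsey_number a2 a3 - 1"
    unfolding r_star_def feas_iff by (intro Greatest_equality) auto
  have "\<xi> {x} = \<xi> {y}" if "feasible ?Hs (r_star ?Hs) \<xi>" "x < r_star ?Hs" "y < r_star ?Hs" for \<xi> x y
  proof (rule ccontr)
    assume "\<xi> {x} \<noteq> \<xi> {y}"
    \<comment> \<open>The extra vertex would give a Ramsey graph of order
      \<open>ramsey_number a2 a3\<close>.\<close>
    then have "realizable (Suc (r_star ?Hs)) (a2 - 1) (a3 - 1)"
      using feasible_imp_realizable(2)[OF assms that(1)] that(2,3) by blast
    then show False
      unfolding real_iff r by simp
  qed
  then show ?thesis
    using r unfolding nice_def by blast
qed

end
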